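(* Let $q$ be a prime power and let $\ell, m$ be positive integers with $\ell < m < q$. Let $(\bm{A}, \bm{B}, \pi)$ be the output of $\mathsf{GenPKP}^\star(q,\ell,m,1)$, i.e.\ $\pi$ is uniformly random in $\mathbb{S}_m$, $\bm{B}$ is uniformly random in $\mathbb{F}_q^{\star m \times 1, 1}$ (independent of $\pi$), and, given $(\pi,\bm{B})$, $\bm{A}$ is uniformly random among the matrices in $\mathbb{F}_q^{\ell \times m, \ell}$ satisfying $\bm{A}\bm{\pi}\bm{B} = \bm{0}$. Then \[ \mathbb{E}[N_{\mathsf{sol}}(\bm{A}, \bm{B})] = \frac{m!(q^{m - \ell} - q)}{q^m - q} + \frac{q^m - q^{m-\ell}}{(q^m - q)\binom{q-1}{m}} \sum_{d \mid \gcd(q - 1, m)} \varphi(d) \binom{(q-1)/d}{m/d}. \]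
   Context: $\mathbb{F}_q$ is the finite field with $q$ elements. $\mathbb{F}_q^{a \times b, r}$ denotes the set of $a\times b$ matrices over $\mathbb{F}_q$ of rank exactly $r$, and $\mathbb{F}_q^{\star a \times b, r}$ the subset of those whose $a$ rows are nonzero and pairwise distinct (so $\mathbb{F}_q^{\star m\times 1,1}$ is the set of column vectors of length $m$ with pairwise distinct nonzero entries). $\mathbb{S}_m$ is the symmetric group on $\{1,\dots,m\}$; for $\pi\in\mathbb{S}_m$, $\bm{\pi}$ is the $m\times m$ permutation matrix with $(i,j)$ entry $\delta_{\pi(i),j}$. $N_{\mathsf{sol}}(\bm{A},\bm{B})$ is the number of $\rho\in\mathbb{S}_m$ with $\bm{A}\bm{\rho}\bm{B}=\bm{0}$. $\varphi$ is Euler's totient function and the sum runs over positive divisors $d$ of $\gcd(q-1,m)$. *)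

theory Defs
  imports
    "HOL-Probability.Probability_Mass_Function"
    "HOL-Number_Theory.Totient"
    "Jordan_Normal_Form.DL_Rank"
begin

text \<open>
  The field with \<open>q\<close> elements is a type \<open>'a\<close> of sort \<open>{finite, field}\<close> with
  \<open>CARD('a) = q\<close>. Rows, columns and the points moved by permutations are indexed from 0,
  so \<open>{..<m}\<close> plays the role of \<open>{1, ..., m}\<close>.
\<close>

definition mats_of_rank :: "nat \<Rightarrow> nat \<Rightarrow> nat \<Rightarrow> 'a::field Matrix.mat set" where
  "mats_of_rank a b r = {M \<in> carrier_mat a b. vec_space.rank a M = r}"

definition star_mats_of_rank :: "nat \<Rightarrow> nat \<Rightarrow> nat \<Rightarrow> 'a::field Matrix.mat set" where
  "star_mats_of_rank a b r =
     {M \<in> mats_of_rank a b r.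
        (\<forall>i<a. Matrix.row M i \<noteq> 0\<^sub>v b) \<and> inj_on (Matrix.row M) {..<a}}"

definition perm_mat :: "nat \<Rightarrow> (nat \<Rightarrow> nat) \<Rightarrow> 'a::field Matrix.mat" where
  "perm_mat m \<pi> = Matrix.mat m m (\<lambda>(i, j). if \<pi> i = j then 1 else 0)"

definition is_pkp_solution ::
  "nat \<Rightarrow> nat \<Rightarrow> nat \<Rightarrow> 'a::field Matrix.mat \<Rightarrow> 'a Matrix.mat \<Rightarrow> (nat \<Rightarrow> nat) \<Rightarrow> bool" where
  "is_pkp_solution l m n A B \<rho> \<longleftrightarrow> A * perm_mat m \<rho> * B = 0\<^sub>m l n"

definition N_sol :: "nat \<Rightarrow> nat \<Rightarrow> nat \<Rightarrow> 'a::field Matrix.mat \<Rightarrow> 'a Matrix.mat \<Rightarrow> nat" where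
  "N_sol l m n A B = card {\<rho>. \<rho> permutes {..<m} \<and> is_pkp_solution l m n A B \<rho>}"

text \<open>
  The distribution is meaningful only if the three sets sampled from are nonempty; for
  \<open>n = 1\<close> this is the case whenever \<open>l < m < CARD('a)\<close>.
\<close>

definition GenPKP_star ::
  "nat \<Rightarrow> nat \<Rightarrow> nat \<Rightarrow>
     ('a::{finite, field} Matrix.mat \<times> 'a Matrix.mat \<times> (nat \<Rightarrow> nat)) pmf" where
  "GenPKP_star l m n =
     do {
       \<pi> \<leftarrow> pmf_of_set {\<pi>. \<pi> permutes {..<m}};
       B \<leftarrow> pmf_of_set (star_mats_of_rank m n n);
       A \<leftarrow> pmf_of_set {A \<in> mats_of_rank l m l. is_pkp_solution l m n A B \<pi>};
       return_pmf (A, B, \<pi>)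
     }"

end

theory Submission
  imports Defs "HOL-Algebra.Multiplicative_Group"
begin

text \<open>
  Put \<open>v = \<pi>B\<close> and \<open>w = \<rho>B\<close>. If \<open>w\<close> is a multiple of \<open>v\<close>, then \<open>\<rho>\<close> is a solution with
  probability 1. Otherwise the transvections fixing \<open>v\<close> act transitively on the vectors outside
  the line of \<open>v\<close>, so the number of full-rank \<open>A\<close> with \<open>Av = Aw = 0\<close> does not depend on \<open>w\<close>; as
  each kernel has \<open>q ^ (m - l)\<close> elements, double counting gives the probability
  \<open>(q ^ (m - l) - q) / (q ^ m - q)\<close>.

  It remains to count the \<open>\<rho>\<close> with \<open>\<rho>B\<close> proportional to \<open>\<pi>B\<close>. These correspond to the scalars
  \<open>c\<close> with \<open>cS = S\<close>, where \<open>S\<close> is the set of entries of \<open>B\<close>. Summed over all \<open>m\<close>-element sets \<open>S\<close> of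
  nonzero scalars, this is the number of pairs \<open>(c, S)\<close> with \<open>cS = S\<close>. For \<open>c\<close> of order \<open>d\<close> the
  invariant sets are the unions of \<open>m / d\<close> cosets of the group generated by \<open>c\<close>, and there are
  \<open>\<phi>(d)\<close> scalars of order \<open>d\<close>.
\<close>

unbundle no vec_syntax

section \<open>Matrices of full row rank\<close>

text \<open>Rank \<open>n\<close> yields \<open>n\<close> independent columns in an
  \<open>n\<close>-dimensional space, hence a basis; conversely the rank is the dimension of the
  column span. Full rank is used below as surjectivity, since that survives composition with a
  surjective map.\<close>

lemma rank_eq_nrows_iff:
  fixes A :: "'a::field Matrix.mat"
  assumes A: "A \<in> carrier_mat n k"
  shows "vec_space.rank n A = n \<longleftrightarrow>
    (\<forall>y\<in>carrier_vec n. \<exists>x\<in>carrier_vec k. A *\<^sub>v x = y)"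
proof -
  interpret vec_space "TYPE('a)" n .
  have cols: "set (cols A) \<subseteq> carrier_vec n" using A cols_dim by blast
  have "rank A = n \<longleftrightarrow> span (set (cols A)) = carrier_vec n"
  proof
    assume r: "rank A = n"
    have "lin_indpt {}" by (rule finite_lin_indpt2) auto
    then obtain S where S: "finite S" "maximal S (\<lambda>T. T \<subseteq> set (cols A) \<and> lin_indpt T)"
      using maximal_exists_superset[OF List.finite_set[of "cols A"],
          of "\<lambda>T. T \<subseteq> set (cols A) \<and> lin_indpt T" "{}"] by auto
    have "card S = n" using rank_card_indpt[OF A S(2)] r by simp
    moreover have S': "S \<subseteq> set (cols A)" "lin_indpt S" using S(2) by (auto simp: maximal_def)
    ultimately have "basis S"
      using S(1) cols by (intro dim_li_is_basis) (auto simp: dim_is_n)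
    then have "span S = carrier_vec n" by (simp add: basis_def)
    then show "span (set (cols A)) = carrier_vec n"
      using span_is_monotone[OF S'(1)] span_is_subset2[OF cols[folded module_vec_simps(3)]] by auto
  next
    assume "span (set (cols A)) = carrier_vec n"
    then have "rank A = vectorspace.dim class_ring (vs (carrier V))"
      by (simp add: rank_def)
    then show "rank A = n" using dim_is_n by (simp add: module_vec_def)
  qed
  also have "\<dots> \<longleftrightarrow> (\<forall>y\<in>carrier_vec n. \<exists>x\<in>carrier_vec k. A *\<^sub>v x = y)"
    using col_space_eq[OF A] A by (auto simp: col_space_def)
  finally show ?thesis .
qed

lemma rank_nonzero_column:
  fixes B :: "'a::field Matrix.mat"
  assumes B: "B \<in> carrier_mat n 1" and nz: "i < n" "B $$ (i, 0) \<noteq> 0"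
  shows "vec_space.rank n B = 1"
proof -
  interpret vec_space "TYPE('a)" n .
  have cols: "cols B = [col B 0]" using B by (auto simp: cols_def)
  have c: "col B 0 \<in> carrier_vec n" using B by auto
  have "col B 0 $ i \<noteq> 0" using B nz by auto
  then have "col B 0 \<noteq> 0\<^sub>v n" using nz by auto
  moreover have "lin_indpt {}" by (rule finite_lin_indpt2) auto
  ultimately have "lin_indpt {col B 0}"
    using lin_dep_iff_in_span[of "{}" "col B 0"] c by (auto simp: span_empty)
  then show ?thesis using lin_indpt_full_rank[OF B] cols by auto
qed

text \<open>Row \<open>i\<close> of the permutation matrix selects entry \<open>\<rho> i\<close> of
  the column. This turns the matrix equation into a question about vectors in the kernel of
  \<open>A\<close>.\<close>

lemma is_pkp_solution_iff:
  fixes A B :: "'a::field Matrix.mat"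
  assumes A: "A \<in> carrier_mat l m" and B: "B \<in> carrier_mat m 1" and p: "\<rho> permutes {..<m}"
  shows "is_pkp_solution l m 1 A B \<rho> \<longleftrightarrow> A *\<^sub>v vec m (\<lambda>i. B $$ (\<rho> i, 0)) = 0\<^sub>v l"
proof -
  let ?P = "perm_mat m \<rho> :: 'a Matrix.mat"
  have P: "?P \<in> carrier_mat m m" by (simp add: perm_mat_def)
  have r: "\<rho> i < m" if "i < m" for i using permutes_in_image[OF p] that by auto
  have PB: "?P * B = Matrix.mat m 1 (\<lambda>(i, j). B $$ (\<rho> i, 0))"
  proof (rule eq_matI)
    fix i j assume "i < dim_row (Matrix.mat m 1 (\<lambda>(i, j). B $$ (\<rho> i, 0)))"
      "j < dim_col (Matrix.mat m 1 (\<lambda>(i, j). B $$ (\<rho> i, 0)))"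
    then have ij: "i < m" "j = 0" by auto
    have "(?P * B) $$ (i, j) = (\<Sum>k<m. (if \<rho> i = k then 1 else 0) * B $$ (k, 0))"
      using ij B P by (auto simp: scalar_prod_def perm_mat_def lessThan_atLeast0 intro!: sum.cong)
    also have "\<dots> = (\<Sum>k<m. if k = \<rho> i then B $$ (k, 0) else 0)"
      by (intro sum.cong) auto
    also have "\<dots> = B $$ (\<rho> i, 0)" using r[OF ij(1)] by simp
    finally show "(?P * B) $$ (i, j) = Matrix.mat m 1 (\<lambda>(i, j). B $$ (\<rho> i, 0)) $$ (i, j)"
      using ij by simp
  qed (use B P in auto)
  have "A * ?P * B = A * (?P * B)" using A P B by (rule assoc_mult_mat)
  also have "\<dots> = 0\<^sub>m l 1 \<longleftrightarrow> (\<forall>i<l. Matrix.row A i \<bullet> vec m (\<lambda>i. B $$ (\<rho> i, 0)) = 0)"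
    using A unfolding PB mat_eq_iff by auto
  also have "\<dots> \<longleftrightarrow> A *\<^sub>v vec m (\<lambda>i. B $$ (\<rho> i, 0)) = 0\<^sub>v l"
    using A by (auto simp: vec_eq_iff)
  finally show ?thesis by (simp add: is_pkp_solution_def)
qed

section \<open>Sizes of vector spaces, matrix spaces and kernels\<close>

lemma bij_betw_vec_PiE:
  "bij_betw (\<lambda>v. restrict (($) v) {..<n}) (carrier_vec n) ({..<n} \<rightarrow>\<^sub>E UNIV)"
  by (rule bij_betw_byWitness[where f' = "vec n"])
     (auto simp: fun_eq_iff restrict_def PiE_def extensional_def)

lemma finite_carrier_vec [simp]: "finite (carrier_vec n :: 'a::finite Matrix.vec set)"
  by (rule bij_betw_finite[OF bij_betw_vec_PiE, THEN iffD2]) (intro finite_PiE, auto)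

lemma card_carrier_vec: "card (carrier_vec n :: 'a::finite Matrix.vec set) = CARD('a) ^ n"
  using bij_betw_same_card[OF bij_betw_vec_PiE] by (simp add: card_funcsetE)

lemma finite_carrier_mat [simp]: "finite (carrier_mat n k :: 'a::finite Matrix.mat set)"
proof (rule finite_surj)
  show "finite (({..<n} \<times> {..<k}) \<rightarrow>\<^sub>E (UNIV :: 'a set))" by (auto intro: finite_PiE)
  show "(carrier_mat n k :: 'a Matrix.mat set) \<subseteq> Matrix.mat n k ` (({..<n} \<times> {..<k}) \<rightarrow>\<^sub>E (UNIV :: 'a set))"
  proof
    fix A :: "'a Matrix.mat" assume "A \<in> carrier_mat n k"
    then have "A = Matrix.mat n k (restrict (($$) A) ({..<n} \<times> {..<k}))"
      by (auto simp: mat_eq_iff)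
    then show "A \<in> Matrix.mat n k ` (({..<n} \<times> {..<k}) \<rightarrow>\<^sub>E (UNIV :: 'a set))" by auto
  qed
qed

text \<open>The fibres of a surjective linear map are translates of its kernel, so the whole space
  splits into \<open>CARD('a) ^ l\<close> classes of equal size. The product form avoids the
  truncated subtraction \<open>m - l\<close>.\<close>

lemma card_kernel_of_full_rank:
  fixes A :: "'a::{finite, field} Matrix.mat"
  assumes A: "A \<in> mats_of_rank l m l"
  shows "CARD('a) ^ l * card {x \<in> carrier_vec m. A *\<^sub>v x = 0\<^sub>v l} = CARD('a) ^ m"
proof -
  let ?K = "\<lambda>y. {x \<in> carrier_vec m. A *\<^sub>v x = y}"
  have surj: "\<exists>x\<in>carrier_vec m. A *\<^sub>v x = y" if "y \<in> carrier_vec l" for y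
    using A rank_eq_nrows_iff[of A l m] that by (auto simp: mats_of_rank_def)
  have Ac: "A \<in> carrier_mat l m" using A by (auto simp: mats_of_rank_def)
  have fib: "card (?K y) = card (?K (0\<^sub>v l))" if y: "y \<in> carrier_vec l" for y
  proof -
    obtain x0 where x0: "x0 \<in> carrier_vec m" "A *\<^sub>v x0 = y" using surj[OF y] by auto
    have "bij_betw (\<lambda>x. x + x0) (?K (0\<^sub>v l)) (?K y)"
      by (rule bij_betw_byWitness[where f' = "\<lambda>x. x - x0"])
         (use x0 y Ac in \<open>auto simp: mult_add_distrib_mat_vec mult_minus_distrib_mat_vec\<close>)
    from bij_betw_same_card[OF this] show ?thesis by simp
  qed
  have "CARD('a) ^ m = card (carrier_vec m :: 'a Matrix.vec set)" by (simp add: card_carrier_vec)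
  also have "\<dots> = (\<Sum>y\<in>carrier_vec l. card (?K y))"
    using Ac by (subst card_UN_disjoint[symmetric]) (auto intro!: arg_cong[where f = card])
  also have "\<dots> = (\<Sum>y\<in>(carrier_vec l :: 'a Matrix.vec set). card (?K (0\<^sub>v l)))"
    by (intro sum.cong refl fib)
  also have "\<dots> = CARD('a) ^ l * card (?K (0\<^sub>v l))"
    by (simp add: card_carrier_vec)
  finally show ?thesis by simp
qed

section \<open>Full-rank matrices annihilating one or two vectors\<close>

abbreviation annihilators :: "nat \<Rightarrow> nat \<Rightarrow> 'a::field Matrix.vec \<Rightarrow> 'a Matrix.mat set" where
  "annihilators l m v \<equiv> {A \<in> mats_of_rank l m l. A *\<^sub>v v = 0\<^sub>v l}"

abbreviation line :: "'a::field Matrix.vec \<Rightarrow> 'a Matrix.vec set" where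
  "line v \<equiv> range (\<lambda>c. c \<cdot>\<^sub>v v)"

text \<open>The functional is the 2 by 2 minor \<open>v $ i * x $ j - v $ j * x $ i\<close>. With
  \<open>v $ i\<close> nonzero, \<open>w\<close> differs from the multiple of \<open>v\<close> that
  agrees with it at \<open>i\<close>, and \<open>j\<close> is a coordinate where the difference
  shows.\<close>

lemma separating_functional:
  fixes v w :: "'a::field Matrix.vec"
  assumes "v \<in> carrier_vec m" "w \<in> carrier_vec m" "v \<noteq> 0\<^sub>v m" "w \<notin> line v"
  shows "\<exists>f\<in>carrier_vec m. f \<bullet> v = 0 \<and> f \<bullet> w \<noteq> 0"
proof -
  obtain i where i: "i < m" "v $ i \<noteq> 0" using assms(1,3) by (auto simp: vec_eq_iff)
  have "w \<noteq> (w $ i / v $ i) \<cdot>\<^sub>v v" using assms(4) by blast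
  then obtain j where j: "j < m" "w $ j \<noteq> w $ i / v $ i * v $ j"
    using assms(1,2) by (auto simp: vec_eq_iff)
  let ?f = "v $ i \<cdot>\<^sub>v unit_vec m j - v $ j \<cdot>\<^sub>v unit_vec m i"
  have f: "?f \<bullet> x = v $ i * x $ j - v $ j * x $ i" if "x \<in> carrier_vec m" for x
    using that i j by (subst minus_scalar_prod_distrib) auto
  have "?f \<bullet> v = 0" using f[OF assms(1)] by simp
  moreover have "?f \<bullet> w \<noteq> 0" using f[OF assms(2)] i j by (auto simp: field_simps)
  ultimately show ?thesis by (intro bexI[of _ ?f]) auto
qed

text \<open>Take one functional for \<open>w\<close> and one for \<open>w'\<close>. Either one of
  them serves both vectors, or each vanishes on the other's vector and their sum serves. Scaling
  then normalises the value at \<open>w\<close>.\<close>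

lemma common_separating_functional:
  fixes v w w' :: "'a::field Matrix.vec"
  assumes "v \<in> carrier_vec m" "v \<noteq> 0\<^sub>v m"
    and "w \<in> carrier_vec m" "w \<notin> line v" and "w' \<in> carrier_vec m" "w' \<notin> line v"
  shows "\<exists>f\<in>carrier_vec m. f \<bullet> v = 0 \<and> f \<bullet> w = 1 \<and> f \<bullet> w' \<noteq> 0"
proof -
  obtain f where f: "f \<in> carrier_vec m" "f \<bullet> v = 0" "f \<bullet> w \<noteq> 0"
    using separating_functional[OF assms(1,3,2,4)] by blast
  obtain g where g: "g \<in> carrier_vec m" "g \<bullet> v = 0" "g \<bullet> w' \<noteq> 0"
    using separating_functional[OF assms(1,5,2,6)] by blast
  have "\<exists>h\<in>carrier_vec m. h \<bullet> v = 0 \<and> h \<bullet> w \<noteq> 0 \<and> h \<bullet> w' \<noteq> 0"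
  proof (cases "f \<bullet> w' = 0 \<and> g \<bullet> w = 0")
    case True
    then show ?thesis using f g assms
      by (intro bexI[of _ "f + g"]) (auto simp: add_scalar_prod_distrib[where n = m])
  qed (use f g in blast)
  then obtain h where h: "h \<in> carrier_vec m" "h \<bullet> v = 0" "h \<bullet> w \<noteq> 0" "h \<bullet> w' \<noteq> 0" by blast
  then show ?thesis using assms
    by (intro bexI[of _ "(1 / (h \<bullet> w)) \<cdot>\<^sub>v h"]) auto
qed

text \<open>
  With \<open>f v = 0\<close>, \<open>f w = 1\<close>, \<open>f w' \<noteq> 0\<close> and \<open>u = w' - w\<close>, the map \<open>T x = x + f x * u\<close> is invertible,
  fixes \<open>v\<close> and sends \<open>w\<close> to \<open>w'\<close>, so \<open>A \<mapsto> A T\<close> embeds the one set into the other.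
\<close>

lemma card_common_annihilators_le:
  fixes v w w' :: "'a::{finite, field} Matrix.vec"
  assumes v: "v \<in> carrier_vec m" "v \<noteq> 0\<^sub>v m"
    and w: "w \<in> carrier_vec m" "w \<notin> line v" and w': "w' \<in> carrier_vec m" "w' \<notin> line v"
  shows "card {A \<in> annihilators l m v. A *\<^sub>v w' = 0\<^sub>v l} \<le> card {A \<in> annihilators l m v. A *\<^sub>v w = 0\<^sub>v l}"
proof -
  obtain f where f: "f \<in> carrier_vec m" "f \<bullet> v = 0" "f \<bullet> w = 1" "f \<bullet> w' \<noteq> 0"
    using common_separating_functional[OF v w w'] by blast
  define u where "u = w' - w"
  have u: "u \<in> carrier_vec m" using w w' by (simp add: u_def)
  define T where "T = (\<lambda>x. x + (f \<bullet> x) \<cdot>\<^sub>v u)"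
  \<comment> \<open>This is \<open>A\<close> plus the outer product of \<open>A u\<close> and
    \<open>f\<close>, that is, the matrix of \<open>A\<close> composed with
    \<open>T\<close>.\<close>
  define \<Phi> where "\<Phi> = (\<lambda>A. Matrix.mat l m (\<lambda>(i, j). A $$ (i, j) + (A *\<^sub>v u) $ i * f $ j))"
  have T: "T x \<in> carrier_vec m" if "x \<in> carrier_vec m" for x using that u by (simp add: T_def)
  have \<Phi>c: "\<Phi> A \<in> carrier_mat l m" for A by (simp add: \<Phi>_def)
  have \<Phi>: "\<Phi> A *\<^sub>v x = A *\<^sub>v T x" if A: "A \<in> carrier_mat l m" and x: "x \<in> carrier_vec m" for A x
  proof (rule eq_vecI)
    fix i assume "i < dim_vec (A *\<^sub>v T x)"
    then have i: "i < l" using A by simp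
    have "(\<Phi> A *\<^sub>v x) $ i = (\<Sum>j = 0..<m. (A $$ (i, j) + (A *\<^sub>v u) $ i * f $ j) * x $ j)"
      using i x by (simp add: \<Phi>_def scalar_prod_def)
    also have "\<dots> = (\<Sum>j = 0..<m. A $$ (i, j) * x $ j) + (A *\<^sub>v u) $ i * (\<Sum>j = 0..<m. f $ j * x $ j)"
      by (simp only: distrib_right sum.distrib sum_distrib_left mult.assoc)
    also have "\<dots> = (A *\<^sub>v x) $ i + (A *\<^sub>v u) $ i * (f \<bullet> x)"
      using i x A by (simp add: scalar_prod_def)
    also have "\<dots> = (A *\<^sub>v T x) $ i"
      using i x A u by (simp add: T_def mult_add_distrib_mat_vec mult_mat_vec)
    finally show "(\<Phi> A *\<^sub>v x) $ i = (A *\<^sub>v T x) $ i" .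
  qed (use A in \<open>auto simp: \<Phi>_def\<close>)
  have fu: "f \<bullet> u = f \<bullet> w' - 1"
    unfolding u_def using f w w' by (subst scalar_prod_minus_distrib) auto
  have surjT: "\<exists>x\<in>carrier_vec m. T x = y" if y: "y \<in> carrier_vec m" for y
  proof -
    \<comment> \<open>Applying \<open>f\<close> to \<open>y = x + (f x) u\<close> gives
      \<open>f y = (f x)(1 + f u) = (f x)(f w')\<close>. Hence \<open>?c\<close> is the value of
      \<open>f\<close> at the preimage, and \<open>?x\<close> is forced.\<close>
    let ?c = "(f \<bullet> y) / (f \<bullet> w')"
    let ?x = "y - ?c \<cdot>\<^sub>v u"
    have "f \<bullet> ?x = f \<bullet> y - ?c * (f \<bullet> u)"
      using f y u by (subst scalar_prod_minus_distrib) auto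
    also have "\<dots> = ?c" using f(4) by (simp add: fu field_simps)
    finally have "T ?x = y" using y u by (auto simp: T_def vec_eq_iff)
    then show ?thesis using y u by (intro bexI[of _ ?x]) auto
  qed
  have Tv: "T v = v" using v u f by (auto simp: T_def vec_eq_iff)
  have Tw: "T w = w'" using w w' f by (auto simp: T_def u_def vec_eq_iff)
  show ?thesis
  proof (rule card_inj_on_le[where f = \<Phi>])
    show "inj_on \<Phi> {A \<in> annihilators l m v. A *\<^sub>v w' = 0\<^sub>v l}"
    proof (rule inj_onI)
      fix A B assume "A \<in> {A \<in> annihilators l m v. A *\<^sub>v w' = 0\<^sub>v l}"
        "B \<in> {A \<in> annihilators l m v. A *\<^sub>v w' = 0\<^sub>v l}" and eq: "\<Phi> A = \<Phi> B"
      then have AB: "A \<in> carrier_mat l m" "B \<in> carrier_mat l m" by (auto simp: mats_of_rank_def)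
      \<comment> \<open>The image of \<open>T\<close> is the whole space, so \<open>A\<close> is
        determined by its composition with \<open>T\<close>.\<close>
      have "A *\<^sub>v y = B *\<^sub>v y" if "y \<in> carrier_vec m" for y
        using surjT[OF that] \<Phi>[OF AB(1)] \<Phi>[OF AB(2)] eq by metis
      then have AB_unit: "(A *\<^sub>v unit_vec m j) $ i = (B *\<^sub>v unit_vec m j) $ i" for i j by simp
      show "A = B"
      proof (rule eq_matI)
        fix i j assume "i < dim_row B" "j < dim_col B"
        then show "A $$ (i, j) = B $$ (i, j)" using AB_unit[of j i] AB by simp
      qed (use AB in auto)
    qed
    show "\<Phi> ` {A \<in> annihilators l m v. A *\<^sub>v w' = 0\<^sub>v l} \<subseteq> {A \<in> annihilators l m v. A *\<^sub>v w = 0\<^sub>v l}"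
    proof clarify
      fix A assume A: "A \<in> mats_of_rank l m l" "A *\<^sub>v v = 0\<^sub>v l" "A *\<^sub>v w' = 0\<^sub>v l"
      have Ac: "A \<in> carrier_mat l m" and surj: "\<forall>y\<in>carrier_vec l. \<exists>x\<in>carrier_vec m. A *\<^sub>v x = y"
        using A(1) rank_eq_nrows_iff[of A l m] by (auto simp: mats_of_rank_def)
      have "\<exists>x\<in>carrier_vec m. \<Phi> A *\<^sub>v x = y" if "y \<in> carrier_vec l" for y
        using surj that surjT \<Phi>[OF Ac] by metis
      then have "\<Phi> A \<in> mats_of_rank l m l"
        using rank_eq_nrows_iff[OF \<Phi>c] \<Phi>c by (auto simp: mats_of_rank_def)
      then show "\<Phi> A \<in> annihilators l m v \<and> \<Phi> A *\<^sub>v w = 0\<^sub>v l"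
        using \<Phi>[OF Ac] v(1) w(1) Tv Tw A by simp
    qed
    show "finite {A \<in> annihilators l m v. A *\<^sub>v w = 0\<^sub>v l}"
      by (rule finite_subset[OF _ finite_carrier_mat[of l m]]) (auto simp: mats_of_rank_def)
  qed
qed

text \<open>Pairs of a matrix in \<open>annihilators l m v\<close> and a kernel vector off the line
  of \<open>v\<close> are counted in two ways. All vectors off the line contribute equally; each
  matrix contributes its kernel minus the line, which that kernel contains. For \<open>l = m\<close>
  there is no such matrix and both sides are zero.\<close>

lemma card_common_annihilators:
  fixes v w :: "'a::{finite, field} Matrix.vec"
  assumes v: "v \<in> carrier_vec m" "v \<noteq> 0\<^sub>v m" and w: "w \<in> carrier_vec m" "w \<notin> line v"
    and lm: "l \<le> m"
  shows "real (card {A \<in> annihilators l m v. A *\<^sub>v w = 0\<^sub>v l}) * (real CARD('a) ^ m - real CARD('a))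
    = real (card (annihilators l m v)) * (real CARD('a) ^ (m - l) - real CARD('a))"
proof -
  let ?q = "CARD('a)"
  let ?K = "annihilators l m v"
  let ?W = "carrier_vec m - line v"
  obtain i where i: "i < m" "v $ i \<noteq> 0" using v by (auto simp: vec_eq_iff)
  have "inj (\<lambda>c. c \<cdot>\<^sub>v v)"
  proof (rule injI)
    fix c d assume "c \<cdot>\<^sub>v v = d \<cdot>\<^sub>v v"
    then have "(c \<cdot>\<^sub>v v) $ i = (d \<cdot>\<^sub>v v) $ i" by simp
    then show "c = d" using i v by auto
  qed
  then have cl: "card (line v) = ?q" by (simp add: card_image)
  have ls: "line v \<subseteq> carrier_vec m" using v by auto
  have finK: "finite ?K"
    by (rule finite_subset[OF _ finite_carrier_mat[of l m]]) (auto simp: mats_of_rank_def)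
  have finW: "finite ?W" by simp
  have "?q \<le> card (carrier_vec m :: 'a Matrix.vec set)"
    using card_mono[OF _ ls] by (simp add: cl)
  then have cW: "real (card ?W) = real ?q ^ m - real ?q"
    using ls by (simp add: card_Diff_subset cl card_carrier_vec of_nat_diff)
  have ker: "real (card {w \<in> ?W. A *\<^sub>v w = 0\<^sub>v l}) = real ?q ^ (m - l) - real ?q" if A: "A \<in> ?K" for A
  proof -
    have Ac: "A \<in> carrier_mat l m" using A by (auto simp: mats_of_rank_def)
    have eq: "{w \<in> ?W. A *\<^sub>v w = 0\<^sub>v l} = {x \<in> carrier_vec m. A *\<^sub>v x = 0\<^sub>v l} - line v" by auto
    have sub: "line v \<subseteq> {x \<in> carrier_vec m. A *\<^sub>v x = 0\<^sub>v l}"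
      using A Ac v by (auto simp: mult_mat_vec)
    have "?q ^ l * card {x \<in> carrier_vec m. A *\<^sub>v x = 0\<^sub>v l} = ?q ^ l * ?q ^ (m - l)"
      using card_kernel_of_full_rank[of A l m] A lm by (simp flip: power_add)
    then have ck: "card {x \<in> carrier_vec m. A *\<^sub>v x = 0\<^sub>v l} = ?q ^ (m - l)" by simp
    then have "?q \<le> ?q ^ (m - l)" using card_mono[OF _ sub] by (simp add: cl)
    then show ?thesis unfolding eq using sub by (simp add: card_Diff_subset cl ck of_nat_diff)
  qed
  have "real (card {A \<in> ?K. A *\<^sub>v w = 0\<^sub>v l}) * (real ?q ^ m - real ?q)
     = (\<Sum>w'\<in>?W. real (card {A \<in> ?K. A *\<^sub>v w = 0\<^sub>v l}))"
    by (simp add: cW)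
  \<comment> \<open>The inequality holds with \<open>w\<close> and \<open>w'\<close> exchanged, so
    all counts off the line agree.\<close>
  also have "\<dots> = (\<Sum>w'\<in>?W. real (card {A \<in> ?K. A *\<^sub>v w' = 0\<^sub>v l}))"
    using card_common_annihilators_le[OF v] w by (intro sum.cong refl) (auto intro!: antisym)
  also have "\<dots> = (\<Sum>w'\<in>?W. \<Sum>A\<in>?K. if A *\<^sub>v w' = 0\<^sub>v l then 1 else 0)"
    using finK by (intro sum.cong refl) (subst sum.If_cases, auto simp: Int_def intro!: arg_cong[where f = card])
  also have "\<dots> = (\<Sum>A\<in>?K. \<Sum>w'\<in>?W. if A *\<^sub>v w' = 0\<^sub>v l then 1 else 0)" by (rule sum.swap)
  also have "\<dots> = (\<Sum>A\<in>?K. real (card {w \<in> ?W. A *\<^sub>v w = 0\<^sub>v l}))"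
    using finW by (intro sum.cong refl) (subst sum.If_cases, auto simp: Int_def intro!: arg_cong[where f = card])
  also have "\<dots> = real (card ?K) * (real ?q ^ (m - l) - real ?q)"
    using ker by simp
  finally show ?thesis .
qed

text \<open>Row \<open>i\<close> is the minor pairing coordinates 0 and \<open>Suc i\<close>, so it
  vanishes on \<open>v\<close>. Columns 1 to \<open>l\<close>, present because \<open>l < m\<close>,
  form \<open>v $ 0\<close> times the identity, which gives surjectivity.\<close>

lemma annihilators_nonempty:
  fixes v :: "'a::field Matrix.vec"
  assumes v: "v \<in> carrier_vec m" "v $ 0 \<noteq> 0" and lm: "l < m"
  shows "annihilators l m v \<noteq> {}"
proof -
  define A where "A = Matrix.mat l m (\<lambda>(i, j). if j = Suc i then v $ 0 else if j = 0 then - v $ Suc i else 0)"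
  have Ac: "A \<in> carrier_mat l m" by (simp add: A_def)
  have Ax: "(A *\<^sub>v x) $ i = v $ 0 * x $ Suc i - v $ Suc i * x $ 0" if x: "x \<in> carrier_vec m" and i: "i < l" for x i
  proof -
    have "(A *\<^sub>v x) $ i = (\<Sum>j<m. (if j = Suc i then v $ 0 else if j = 0 then - v $ Suc i else 0) * x $ j)"
      using x i by (simp add: A_def scalar_prod_def lessThan_atLeast0)
    also have "\<dots> = (\<Sum>j<m. (if j = Suc i then v $ 0 * x $ Suc i else 0) + (if j = 0 then - v $ Suc i * x $ 0 else 0))"
      by (intro sum.cong) auto
    also have "\<dots> = v $ 0 * x $ Suc i - v $ Suc i * x $ 0"
      using i lm by (simp add: sum.distrib)
    finally show ?thesis .
  qed
  have "A *\<^sub>v v = 0\<^sub>v l" using Ax[OF v(1)] Ac by (auto simp: vec_eq_iff simp del: index_mult_mat_vec)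
  moreover have "\<exists>x\<in>carrier_vec m. A *\<^sub>v x = y" if y: "y \<in> carrier_vec l" for y
  proof (intro bexI)
    \<comment> \<open>The shift by one matches row \<open>i\<close> with column
      \<open>Suc i\<close>. Beyond coordinate \<open>l\<close> the entry of \<open>y\<close> is out
      of range, but every row of \<open>A\<close> is zero there.\<close>
    let ?x = "vec m (\<lambda>j. if j = 0 then 0 else y $ (j - 1) / v $ 0)"
    show "A *\<^sub>v ?x = y"
      using Ax[of ?x] Ac y lm v by (auto simp: vec_eq_iff simp del: index_mult_mat_vec)
  qed auto
  ultimately have "A \<in> annihilators l m v"
    using rank_eq_nrows_iff[OF Ac] Ac by (auto simp: mats_of_rank_def)
  then show ?thesis by blast
qed

section \<open>Sets invariant under scaling\<close>

lemma phi'_eq_totient: "phi' n = totient n"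
  unfolding phi'_def totient_def totatives_def
  by (rule arg_cong[where f = card]) auto

text \<open>The order of \<open>c\<close> is written as the number of its powers, free of group
  notation. Once some element of order \<open>d\<close> is known, the count is Euler's function;
  cyclicity of the multiplicative group supplies that element.\<close>

lemma card_elements_of_multiplicative_order:
  assumes "d dvd CARD('a) - 1"
  shows "card {c :: 'a::{finite, field}. c \<noteq> 0 \<and> card (range (\<lambda>n::nat. c ^ n)) = d} = totient d"
proof -
  let ?R = "class_ring :: 'a ring"
  let ?G = "mult_of ?R"
  interpret G: group ?G by (rule field.field_mult_group[OF class_field])
  have carr: "carrier ?G = -{0}" by (auto simp: class_ring_simps)
  have fin: "finite (carrier ?R)" by (simp add: class_ring_simps)
  have pow: "x [^]\<^bsub>?G\<^esub> (n::nat) = x ^ n" for x n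
    by (simp add: nat_pow_mult_of class_ring_simps)
  have ordG: "order ?G = CARD('a) - 1"
    by (simp add: order_def carr Compl_eq_Diff_UNIV card_Diff_singleton)
  have ord: "group.ord ?G c = card (range (\<lambda>n::nat. c ^ n))" if "c \<noteq> 0" for c
    using G.generate_pow_card[of c] G.generate_pow_on_finite_carrier[of c] that
    by (simp add: carr pow full_SetCompr_eq)
  obtain g where g: "g \<in> carrier ?G" "carrier ?G = {g [^]\<^bsub>?R\<^esub> i |i::nat. i \<in> UNIV}"
    using field.finite_field_mult_group_has_gen[OF class_field fin] by (auto simp: class_ring_simps)
  have gord: "G.ord g = order ?G"
    using G.generate_pow_card[OF g(1)] G.generate_pow_on_finite_carrier[OF _ g(1)] g
    by (simp add: order_def nat_pow_mult_of carr)
  have pos: "CARD('a) - 1 > 0" using G.order_gt_0_iff_finite by (simp add: ordG carr)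
  obtain e where e: "CARD('a) - 1 = d * e" using assms by auto
  then have e0: "e \<noteq> 0" using pos by (metis less_numeral_extra(3) mult_0_right)
  \<comment> \<open>Raising a generator to the cofactor \<open>e\<close> divides its order by
    \<open>e\<close>, which leaves \<open>d\<close>.\<close>
  have "G.ord (g [^]\<^bsub>?G\<^esub> e) = d"
    using G.ord_pow[OF g(1), of e] pos e e0 by (simp add: gord ordG)
  then have "\<exists>a\<in>carrier ?G. G.ord a = d" using g(1) by blast
  then have "card {a \<in> carrier ?G. G.ord a = d} = phi' d"
    using field.num_elems_of_ord_eq_phi'[OF class_field fin, of d] assms by (simp add: ordG)
  moreover have "{a \<in> carrier ?G. G.ord a = d} = {c. c \<noteq> 0 \<and> card (range (\<lambda>n::nat. c ^ n)) = d}"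
    using ord by (auto simp: carr)
  ultimately show ?thesis by (simp add: phi'_eq_totient)
qed

text \<open>Nonempty disjoint blocks can be recovered from their union, so choosing the union
  amounts to choosing the blocks. A union of size \<open>m\<close> takes \<open>m div d\<close> of
  the \<open>card X div d\<close> blocks.\<close>

lemma card_unions_of_blocks:
  assumes fin: "finite X" and P: "partition_on X P" and block: "\<And>p. p \<in> P \<Longrightarrow> card p = d" and d: "d > 0"
  shows "card {S. card S = m \<and> (\<exists>T\<subseteq>P. S = \<Union>T)}
    = (if d dvd m then (card X div d) choose (m div d) else 0)"
proof -
  have finP: "finite P" using finite_elements[OF fin P] .
  have disj: "disjoint P" and UP: "\<Union>P = X" and ne: "{} \<notin> P" using P by (auto simp: partition_on_def)
  have finp: "finite p" if "p \<in> P" for p using that UP fin by (meson Union_upper finite_subset)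
  have cU: "card (\<Union>T) = d * card T" if T: "T \<subseteq> P" for T
  proof -
    have "card (\<Union>T) = sum card T"
      using T disj finp by (intro card_Union_disjoint) (auto simp: disjoint_def pairwise_def)
    then show ?thesis using T block by (simp add: subset_iff)
  qed
  have inj: "inj_on Union (Pow P)"
  proof -
    have "T = {p \<in> P. p \<subseteq> \<Union>T}" if T: "T \<subseteq> P" for T
    proof -
      have "p \<in> T" if p: "p \<in> P" "p \<subseteq> \<Union>T" for p
      proof -
        obtain x where x: "x \<in> p" using ne p by (metis ex_in_conv)
        then obtain p' where "p' \<in> T" "x \<in> p'" using p by auto
        then show ?thesis using disjointD[OF disj p(1), of p'] T x by (metis IntI empty_iff subset_iff)
      qed
      then show ?thesis using T by auto
    qed
    then show ?thesis by (intro inj_onI) (metis PowD)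
  qed
  have "{S. card S = m \<and> (\<exists>T\<subseteq>P. S = \<Union>T)} = Union ` {T. T \<subseteq> P \<and> d * card T = m}"
    using cU by auto
  also have "card \<dots> = card {T. T \<subseteq> P \<and> d * card T = m}"
    by (rule card_image) (rule inj_on_subset[OF inj], auto)
  also have "\<dots> = (if d dvd m then (card X div d) choose (m div d) else 0)"
  proof (cases "d dvd m")
    case True
    then have "{T. T \<subseteq> P \<and> d * card T = m} = {T. T \<subseteq> P \<and> card T = m div d}"
      using d by auto
    moreover have "card X = d * card P" using cU[of P] UP by simp
    ultimately show ?thesis using True d n_subsets[OF finP] by simp
  next
    case False
    then have "{T. T \<subseteq> P \<and> d * card T = m} = {}" by auto
    then show ?thesis using False by (simp only: card.empty if_False)
  qed
  finally show ?thesis .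
qed

text \<open>The powers of \<open>c\<close> form a subgroup \<open>H\<close> whose cosets
  \<open>C x\<close> partition the nonzero scalars into blocks of size \<open>d\<close>. The
  invariant sets are the unions of cosets, and the divisibility is Lagrange's theorem for
  \<open>H\<close>.\<close>

lemma card_scaling_invariant_subsets:
  fixes c :: "'a::{finite, field}"
  assumes c: "c \<noteq> 0"
  defines "d \<equiv> card (range (\<lambda>n::nat. c ^ n))"
  shows "d dvd CARD('a) - 1"
    and "card {S. S \<subseteq> -{0} \<and> card S = m \<and> (*) c ` S = S}
      = (if d dvd m then ((CARD('a) - 1) div d) choose (m div d) else 0)"
proof -
  define H where "H = range (\<lambda>n::nat. c ^ n)"
  define C where "C = (\<lambda>x. (\<lambda>h. h * x) ` H)"
  define P where "P = C ` (-{0})"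
  have dH: "d = card H" by (simp add: d_def H_def)
  have H1: "1 \<in> H" unfolding H_def by (metis power_0 rangeI)
  have Hm: "g * h \<in> H" if "g \<in> H" "h \<in> H" for g h
    using that unfolding H_def by (auto simp flip: power_add)
  have H0: "h \<noteq> 0" if "h \<in> H" for h using that c by (auto simp: H_def)
  have Hinv: "\<exists>g\<in>H. g * h = 1" if h: "h \<in> H" for h
  proof -
    \<comment> \<open>Only natural exponents occur in \<open>H\<close>, so inverses come from
      finiteness: multiplication by \<open>h\<close> is injective from \<open>H\<close> into itself
      and therefore reaches 1.\<close>
    have "(\<lambda>g. g * h) ` H \<subseteq> H" using Hm h by auto
    moreover have "inj_on (\<lambda>g. g * h) H" using H0[OF h] by (auto intro: inj_onI)
    ultimately have "(\<lambda>g. g * h) ` H = H" by (intro endo_inj_surj) auto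
    then show ?thesis using H1 by (metis imageE)
  qed
  have mem: "x \<in> C x" for x unfolding C_def using H1 by force
  have Ceq: "C y = C x" if "y \<in> C x" for x y
  proof -
    obtain h where h: "h \<in> H" "y = h * x" using \<open>y \<in> C x\<close> by (auto simp: C_def)
    obtain g where g: "g \<in> H" "g * h = 1" using Hinv h by blast
    have "C y \<subseteq> C x" using h Hm by (auto simp: C_def mult.assoc[symmetric])
    moreover have "k * x = (k * g) * y" for k
      using g h by (metis mult.assoc mult.left_neutral)
    then have "C x \<subseteq> C y" using g Hm unfolding C_def by blast
    ultimately show ?thesis by blast
  qed
  have block: "card p = d" if p: "p \<in> P" for p
  proof -
    obtain x where "x \<noteq> 0" "p = (\<lambda>h. h * x) ` H" using p by (auto simp: P_def C_def)
    then show ?thesis by (simp add: dH card_image inj_on_def)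
  qed
  have d: "d > 0" using H1 by (auto simp: dH card_gt_0_iff)
  have P: "partition_on (-{0}) P"
  proof (rule partition_onI)
    show "\<Union>P = -{0}"
      using mem H0 by (auto simp: P_def) (auto simp: C_def)
    show "{} \<notin> P" using mem by (auto simp: P_def)
    show "disjnt p p'" if "p \<in> P" "p' \<in> P" "p \<noteq> p'" for p p'
      using that Ceq unfolding P_def disjnt_def by blast
  qed
  have cX: "card (-{0::'a}) = CARD('a) - 1"
    by (simp add: Compl_eq_Diff_UNIV card_Diff_singleton)
  show "d dvd CARD('a) - 1"
  proof -
    have "card (\<Union>P) = sum card P"
      using P by (intro card_Union_disjoint) (auto simp: partition_on_def disjoint_def pairwise_def)
    then show ?thesis using block P cX by (simp add: partition_on_def)
  qed
  have inv: "(*) c ` S = S \<longleftrightarrow> (\<exists>T\<subseteq>P. S = \<Union>T)" if S: "S \<subseteq> -{0}" for S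
  proof
    assume cS: "(*) c ` S = S"
    have "c ^ n * x \<in> S" if "x \<in> S" for x n
      using that by (induction n) (use cS in \<open>auto simp: mult.assoc\<close>)
    then have "C x \<subseteq> S" if "x \<in> S" for x using that by (auto simp: C_def H_def)
    then have "S = \<Union>(C ` S)" using mem by blast
    moreover have "C ` S \<subseteq> P" using S by (simp add: P_def image_mono)
    ultimately show "\<exists>T\<subseteq>P. S = \<Union>T" by (intro exI conjI)
  next
    assume "\<exists>T\<subseteq>P. S = \<Union>T"
    then obtain T where T: "T \<subseteq> P" "S = \<Union>T" by blast
    have "c \<in> H" unfolding H_def by (metis power_one_right rangeI)
    have "(*) c ` S \<subseteq> S"
    proof clarify
      fix x assume "x \<in> S"
      then obtain p where p: "p \<in> T" "x \<in> p" using T by auto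
      then have "p = C x" using T Ceq by (auto simp: P_def)
      then have "c * x \<in> p" using \<open>c \<in> H\<close> by (auto simp: C_def)
      then show "c * x \<in> S" using p T by auto
    qed
    \<comment> \<open>On a finite set an injective map into the set is onto, so the inclusion
      suffices.\<close>
    moreover have "inj_on ((*) c) S" using c by (auto intro: inj_onI)
    ultimately show "(*) c ` S = S" by (intro endo_inj_surj) auto
  qed
  have "{S. S \<subseteq> -{0} \<and> card S = m \<and> (*) c ` S = S} = {S. card S = m \<and> (\<exists>T\<subseteq>P. S = \<Union>T)}"
  proof (rule Collect_cong)
    fix S :: "'a set"
    have "S \<subseteq> -{0}" if "\<exists>T\<subseteq>P. S = \<Union>T"
      using that Union_mono[of _ P] P by (auto simp: partition_on_def)
    then show "(S \<subseteq> -{0} \<and> card S = m \<and> (*) c ` S = S) \<longleftrightarrow> (card S = m \<and> (\<exists>T\<subseteq>P. S = \<Union>T))"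
      using inv[of S] by argo
  qed
  then show "card {S. S \<subseteq> -{0} \<and> card S = m \<and> (*) c ` S = S}
      = (if d dvd m then ((CARD('a) - 1) div d) choose (m div d) else 0)"
    using card_unions_of_blocks[OF _ P block d, of m] cX by simp
qed

text \<open>Pairs of a scalar and a set fixed by it are counted first by the set and then by the
  scalar, as in Burnside's lemma. The number of fixed sets depends only on the order
  \<open>d\<close> of the scalar, and orders not dividing \<open>m\<close> contribute zero, which
  leaves the divisors of the gcd.\<close>

lemma sum_card_scaling_stabilizers:
  "(\<Sum>S | S \<subseteq> -{0::'a::{finite, field}} \<and> card S = m. card {c. c \<noteq> 0 \<and> (*) c ` S = S})
   = (\<Sum>d | d dvd gcd (CARD('a) - 1) m. totient d * (((CARD('a) - 1) div d) choose (m div d)))"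
proof -
  let ?n = "CARD('a) - 1"
  let ?o = "\<lambda>c::'a. card (range (\<lambda>n::nat. c ^ n))"
  let ?g = "\<lambda>d. if d dvd m then (?n div d) choose (m div d) else 0"
  have npos: "?n > 0"
    using card_mono[of "UNIV :: 'a set" "{0, 1}"] by simp
  have "(\<Sum>S | S \<subseteq> -{0::'a} \<and> card S = m. card {c. c \<noteq> 0 \<and> (*) c ` S = S})
    = (\<Sum>S | S \<subseteq> -{0::'a} \<and> card S = m. \<Sum>c | c \<noteq> 0. if (*) c ` S = S then 1 else 0)"
    by (intro sum.cong refl) (simp add: sum.If_cases Int_def)
  also have "\<dots> = (\<Sum>c | c \<noteq> 0. \<Sum>S | S \<subseteq> -{0::'a} \<and> card S = m. if (*) c ` S = S then 1 else 0)"
    by (rule sum.swap)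
  also have "\<dots> = (\<Sum>c | c \<noteq> (0::'a). card {S. S \<subseteq> -{0} \<and> card S = m \<and> (*) c ` S = S})"
    by (intro sum.cong refl) (simp add: sum.If_cases Int_def conj_assoc)
  also have "\<dots> = (\<Sum>c | c \<noteq> (0::'a). ?g (?o c))"
    by (intro sum.cong refl card_scaling_invariant_subsets(2)) simp
  also have "\<dots> = (\<Sum>d | d dvd ?n. \<Sum>c | c \<in> {c. c \<noteq> (0::'a)} \<and> ?o c = d. ?g (?o c))"
    using npos card_scaling_invariant_subsets(1)[where 'a = 'a] finite_divisors_nat[OF npos]
    by (intro sum.group[symmetric]) (simp_all add: image_subset_iff)
  also have "\<dots> = (\<Sum>d | d dvd ?n. totient d * ?g d)"
    by (intro sum.cong refl) (simp add: card_elements_of_multiplicative_order)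
  also have "\<dots> = (\<Sum>d | d dvd gcd ?n m. totient d * ((?n div d) choose (m div d)))"
    using npos by (intro sum.mono_neutral_cong_right) auto
  finally show ?thesis .
qed

text \<open>The scalar maps the entry set onto itself and, as \<open>b\<close> is injective,
  determines the permutation. Conversely, a scalar fixing the entry set sends \<open>i\<close> to
  the position of \<open>c * b (\<pi> i)\<close>.\<close>

lemma card_proportional_permutations:
  fixes b :: "nat \<Rightarrow> 'a::field"
  assumes inj: "inj_on b {..<m}" and nz: "\<And>i. i < m \<Longrightarrow> b i \<noteq> 0" and m: "m > 0"
    and pi: "\<pi> permutes {..<m}"
  shows "card {\<rho>. \<rho> permutes {..<m} \<and> (\<exists>c. \<forall>i<m. b (\<rho> i) = c * b (\<pi> i))}
    = card {c. c \<noteq> 0 \<and> (*) c ` (b ` {..<m}) = b ` {..<m}}" (is "card ?R = card ?C")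
proof -
  have perm: "\<rho> i < m" if "\<rho> permutes {..<m}" "i < m" for \<rho> i
    using permutes_in_image[OF that(1)] that(2) by auto
  define f where "f = (\<lambda>\<rho> :: nat \<Rightarrow> nat. b (\<rho> 0) / b (\<pi> 0))"
  have f: "b (\<rho> i) = f \<rho> * b (\<pi> i)" if \<rho>: "\<rho> \<in> ?R" and i: "i < m" for \<rho> i
  proof -
    obtain c where c: "\<forall>i<m. b (\<rho> i) = c * b (\<pi> i)" using \<rho> by auto
    then have "f \<rho> = c" using m nz perm[OF pi m] by (simp add: f_def)
    then show ?thesis using c i by auto
  qed
  have "bij_betw f ?R ?C"
  proof (rule bij_betwI')
    fix \<rho> \<sigma> assume \<rho>: "\<rho> \<in> ?R" and \<sigma>: "\<sigma> \<in> ?R"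
    show "f \<rho> = f \<sigma> \<longleftrightarrow> \<rho> = \<sigma>"
    proof
      assume eq: "f \<rho> = f \<sigma>"
      show "\<rho> = \<sigma>"
      proof
        fix i show "\<rho> i = \<sigma> i"
        proof (cases "i < m")
          case True
          then have "b (\<rho> i) = b (\<sigma> i)" using f[OF \<rho>] f[OF \<sigma>] eq by simp
          then show ?thesis using inj perm \<rho> \<sigma> True by (auto simp: inj_on_def)
        next
          case False
          then show ?thesis using \<rho> \<sigma> by (auto simp: permutes_def)
        qed
      qed
    qed simp
  next
    fix \<rho> assume \<rho>: "\<rho> \<in> ?R"
    then have p: "\<rho> permutes {..<m}" by simp
    have "f \<rho> \<noteq> 0" using nz perm p pi m by (simp add: f_def)
    moreover have "(*) (f \<rho>) ` (b ` {..<m}) = (\<lambda>i. f \<rho> * b i) ` (\<pi> ` {..<m})"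
      by (simp add: image_image permutes_image[OF pi])
    then have "(*) (f \<rho>) ` (b ` {..<m}) = b ` \<rho> ` {..<m}"
      using f[OF \<rho>] by (simp add: image_image)
    ultimately show "f \<rho> \<in> ?C" by (simp add: permutes_image[OF p])
  next
    fix c assume c: "c \<in> ?C"
    \<comment> \<open>Invariance of the entry set makes \<open>c * b (\<pi> i)\<close> an entry;
      outside \<open>{..<m}\<close> the identity is prescribed by \<open>permutes\<close>.\<close>
    define \<rho> where "\<rho> = (\<lambda>i. if i < m then inv_into {..<m} b (c * b (\<pi> i)) else i)"
    have S: "c * b (\<pi> i) \<in> b ` {..<m}" if "i < m" for i
      using c perm[OF pi that] by auto
    have bR: "b (\<rho> i) = c * b (\<pi> i)" if "i < m" for i
      using f_inv_into_f[OF S[OF that]] that by (simp add: \<rho>_def)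
    have "\<rho> ` {..<m} \<subseteq> {..<m}" using inv_into_into[OF S] by (auto simp: \<rho>_def)
    moreover have "inj_on \<rho> {..<m}"
    proof (rule inj_onI)
      fix i j assume ij: "i \<in> {..<m}" "j \<in> {..<m}" "\<rho> i = \<rho> j"
      then have "c * b (\<pi> i) = c * b (\<pi> j)" using bR by (metis lessThan_iff)
      then have "\<pi> i = \<pi> j" using c inj perm[OF pi] ij by (auto simp: inj_on_def)
      then show "i = j" using permutes_inj[OF pi] by (auto simp: inj_on_def)
    qed
    ultimately have "bij_betw \<rho> {..<m} {..<m}"
      by (simp add: bij_betw_def endo_inj_surj)
    then have p: "\<rho> permutes {..<m}" by (intro bij_imp_permutes) (auto simp: \<rho>_def)
    then have "\<rho> \<in> ?R" using bR by auto
    moreover have "c = f \<rho>" using bR[OF m] nz[OF perm[OF pi m]] by (simp add: f_def)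
    ultimately show "\<exists>\<rho>\<in>?R. c = f \<rho>" by blast
  qed
  then show ?thesis by (rule bij_betw_same_card)
qed

section \<open>The expected number of solutions\<close>

declare One_nat_def [simp del]

text \<open>A row of length one is its single entry, and a nonzero entry, available since
  \<open>m > 0\<close>, gives rank one.\<close>

lemma star_column_iff:
  fixes B :: "'a::field Matrix.mat"
  assumes m: "m > 0"
  shows "B \<in> star_mats_of_rank m 1 1 \<longleftrightarrow> B \<in> carrier_mat m 1 \<and>
    (\<forall>i<m. B $$ (i, 0) \<noteq> 0) \<and> inj_on (\<lambda>i. B $$ (i, 0)) {..<m}"
proof (cases "B \<in> carrier_mat m 1")
  case True
  have row: "Matrix.row B i = Matrix.row B j \<longleftrightarrow> B $$ (i, 0) = B $$ (j, 0)"
    "Matrix.row B i \<noteq> 0\<^sub>v 1 \<longleftrightarrow> B $$ (i, 0) \<noteq> 0" if "i < m" "j < m" for i j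
    using True that by (auto simp: vec_eq_iff)
  have "B \<in> star_mats_of_rank m 1 1 \<longleftrightarrow> vec_space.rank m B = 1 \<and>
    (\<forall>i<m. B $$ (i, 0) \<noteq> 0) \<and> inj_on (\<lambda>i. B $$ (i, 0)) {..<m}"
    using True row by (auto simp: star_mats_of_rank_def mats_of_rank_def inj_on_def)
  then show ?thesis using rank_nonzero_column[OF True m] m True by auto
qed (simp add: star_mats_of_rank_def mats_of_rank_def)

text \<open>A column with distinct entries is an ordering of its entry set, so each set arises from
  \<open>fact m\<close> columns. The constant 1 for \<open>g\<close> counts the columns; the
  stabiliser size for \<open>g\<close> links their average to the divisor sum.\<close>

lemma sum_over_star_columns:
  fixes g :: "'a::{finite, field} set \<Rightarrow> nat"
  assumes m: "m > 0"
  shows "(\<Sum>B\<in>star_mats_of_rank m 1 1. g ((\<lambda>i. B $$ (i, 0)) ` {..<m}))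
    = fact m * (\<Sum>S | S \<subseteq> -{0} \<and> card S = m. g S)"
proof -
  let ?e = "\<lambda>B :: 'a Matrix.mat. \<lambda>i. B $$ (i, 0)"
  let ?X = "star_mats_of_rank m 1 1 :: 'a Matrix.mat set"
  let ?Y = "{S. S \<subseteq> -{0::'a} \<and> card S = m}"
  have finX: "finite ?X"
    by (rule finite_subset[OF _ finite_carrier_mat[of m 1]])
      (auto simp: star_mats_of_rank_def mats_of_rank_def)
  have img: "(\<lambda>B. ?e B ` {..<m}) ` ?X \<subseteq> ?Y"
    using m by (auto simp: star_column_iff card_image)
  have fib: "card {B \<in> ?X. ?e B ` {..<m} = S} = fact m" if S: "S \<in> ?Y" for S
  proof -
    let ?F = "{f \<in> {..<m} \<rightarrow>\<^sub>E S. inj_on f {..<m}}"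
    have cS: "card S = m" and S0: "0 \<notin> S" using S by auto
    have onto: "f ` {..<m} = S" if "f \<in> ?F" for f
      using that cS by (intro card_subset_eq) (auto simp: card_image)
    have "bij_betw (\<lambda>f. Matrix.mat m 1 (\<lambda>(i, j). f i)) ?F {B \<in> ?X. ?e B ` {..<m} = S}"
    proof (rule bij_betw_byWitness[where f' = "\<lambda>B. restrict (?e B) {..<m}"])
      show "\<forall>f\<in>?F. restrict (?e (Matrix.mat m 1 (\<lambda>(i, j). f i))) {..<m} = f"
        by (auto simp: fun_eq_iff restrict_def PiE_def extensional_def)
      show "\<forall>B\<in>{B \<in> ?X. ?e B ` {..<m} = S}. Matrix.mat m 1 (\<lambda>(i, j). restrict (?e B) {..<m} i) = B"
        using m by (auto simp: star_column_iff)
      show "(\<lambda>f. Matrix.mat m 1 (\<lambda>(i, j). f i)) ` ?F \<subseteq> {B \<in> ?X. ?e B ` {..<m} = S}"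
      proof (rule image_subsetI)
        fix f assume f: "f \<in> ?F"
        have "f i \<noteq> 0" if "i < m" for i using f S0 that by (auto simp: PiE_def Pi_def)
        moreover have "?e (Matrix.mat m 1 (\<lambda>(i, j). f i)) ` {..<m} = f ` {..<m}" by simp
        ultimately show "Matrix.mat m 1 (\<lambda>(i, j). f i) \<in> {B \<in> ?X. ?e B ` {..<m} = S}"
          using f onto[OF f] m by (simp add: star_column_iff inj_on_def)
      qed
      show "(\<lambda>B. restrict (?e B) {..<m}) ` {B \<in> ?X. ?e B ` {..<m} = S} \<subseteq> ?F"
      proof (rule image_subsetI)
        fix B assume B: "B \<in> {B \<in> ?X. ?e B ` {..<m} = S}"
        then have "inj_on (?e B) {..<m}" using m by (simp add: star_column_iff)
        moreover have "?e B i \<in> S" if "i < m" for i using B that by blast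
        ultimately show "restrict (?e B) {..<m} \<in> ?F" by simp
      qed
    qed
    then have "card {B \<in> ?X. ?e B ` {..<m} = S} = card ?F"
      by (rule bij_betw_same_card[symmetric])
    also have "\<dots> = fact m"
      using card_inj_on_subset_funcset[of "{..<m}" S "{..<m}"] by (simp add: cS fact_prod_rev)
    finally show ?thesis .
  qed
  have "(\<Sum>B\<in>?X. g (?e B ` {..<m})) = (\<Sum>S\<in>?Y. \<Sum>B | B \<in> ?X \<and> ?e B ` {..<m} = S. g (?e B ` {..<m}))"
    using finX img by (intro sum.group[symmetric]) auto
  also have "\<dots> = (\<Sum>S\<in>?Y. fact m * g S)"
    by (intro sum.cong refl) (simp add: fib)
  finally show ?thesis by (simp add: sum_distrib_left)
qed

lemma card_star_columns:
  assumes m: "m > 0"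
  shows "card (star_mats_of_rank m 1 1 :: 'a::{finite, field} Matrix.mat set)
    = fact m * ((CARD('a) - 1) choose m)"
  using sum_over_star_columns[OF m, of "\<lambda>_ :: 'a set. 1"]
  by (simp add: n_subsets Compl_eq_Diff_UNIV card_Diff_singleton)

text \<open>Exchanging the sums over \<open>A\<close> and \<rho> turns the mean into a sum of
  probabilities that \<rho> is a solution: 1 if the two reindexed columns are proportional,
  \<open>r\<close> otherwise. The value is the same for every \<pi> and depends on \<open>B\<close>
  only through \<open>S\<close>.\<close>

lemma mean_N_sol_given_permutation_and_column:
  fixes B :: "'a::{finite, field} Matrix.mat"
  assumes l: "0 < l" "l < m" and B: "B \<in> star_mats_of_rank m 1 1" and p: "\<pi> permutes {..<m}"
  defines "K \<equiv> {A \<in> mats_of_rank l m l. is_pkp_solution l m 1 A B \<pi>}"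
    and "r \<equiv> (real CARD('a) ^ (m - l) - real CARD('a)) / (real CARD('a) ^ m - real CARD('a))"
    and "S \<equiv> (\<lambda>i. B $$ (i, 0)) ` {..<m}"
  shows "K \<noteq> {}"
    and "(\<Sum>A\<in>K. real (N_sol l m 1 A B)) / real (card K)
      = r * fact m + (1 - r) * real (card {c. c \<noteq> 0 \<and> (*) c ` S = S})"
proof -
  let ?q = "CARD('a)"
  define b where "b = (\<lambda>i. B $$ (i, 0))"
  define w where "w = (\<lambda>\<rho> :: nat \<Rightarrow> nat. vec m (\<lambda>i. b (\<rho> i)))"
  have m: "m > 0" using l by simp
  have Bc: "B \<in> carrier_mat m 1" and nz: "\<And>i. i < m \<Longrightarrow> b i \<noteq> 0" and inj: "inj_on b {..<m}"
    using B m by (auto simp: star_column_iff b_def)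
  have wc: "w \<rho> \<in> carrier_vec m" for \<rho> by (simp add: w_def)
  have sol: "is_pkp_solution l m 1 A B \<rho> \<longleftrightarrow> A *\<^sub>v w \<rho> = 0\<^sub>v l"
    if "A \<in> mats_of_rank l m l" "\<rho> permutes {..<m}" for A \<rho>
    using is_pkp_solution_iff[of A l m B \<rho>] that Bc by (simp add: mats_of_rank_def w_def b_def)
  have K: "K = annihilators l m (w \<pi>)" using sol p by (auto simp: K_def)
  have "\<pi> 0 < m" using permutes_in_image[OF p, of 0] m by simp
  then have w0: "w \<pi> $ 0 \<noteq> 0" using m nz by (simp add: w_def)
  then have wnz: "w \<pi> \<noteq> 0\<^sub>v m" using m by auto
  show "K \<noteq> {}" unfolding K using annihilators_nonempty[OF wc w0 l(2)] .
  have finK: "finite K"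
    by (rule finite_subset[OF _ finite_carrier_mat[of l m]]) (auto simp: K_def mats_of_rank_def)
  then have cK: "real (card K) > 0" using \<open>K \<noteq> {}\<close> by (simp add: card_gt_0_iff)
  have "?q \<ge> 2"
    using card_mono[of "UNIV :: 'a set" "{0, 1}"] by simp
  \<comment> \<open>Here \<open>0 < l < m\<close> forces \<open>m \<ge> 2\<close>, so the
    denominator of \<open>r\<close> is positive.\<close>
  then have "real ?q ^ 1 < real ?q ^ m" using l by (intro power_strict_increasing) auto
  then have qm: "real ?q ^ m - real ?q > 0" by simp
  let ?P = "{\<rho>. \<rho> permutes {..<m}}"
  let ?R = "{\<rho>. \<rho> permutes {..<m} \<and> (\<exists>c. \<forall>i<m. b (\<rho> i) = c * b (\<pi> i))}"
  have finP: "finite ?P" by (simp add: finite_permutations)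
  have line: "w \<rho> \<in> line (w \<pi>) \<longleftrightarrow> (\<exists>c. \<forall>i<m. b (\<rho> i) = c * b (\<pi> i))" for \<rho>
    by (auto simp: w_def vec_eq_iff image_iff)
  have prob: "real (card {A \<in> K. A *\<^sub>v w \<rho> = 0\<^sub>v l}) / real (card K)
      = (if \<exists>c. \<forall>i<m. b (\<rho> i) = c * b (\<pi> i) then 1 else r)" for \<rho>
  proof (cases "w \<rho> \<in> line (w \<pi>)")
    case True
    then obtain c where c: "w \<rho> = c \<cdot>\<^sub>v w \<pi>" by auto
    have "A *\<^sub>v w \<rho> = 0\<^sub>v l" if "A \<in> K" for A
    proof -
      have A: "A \<in> carrier_mat l m" "A *\<^sub>v w \<pi> = 0\<^sub>v l" using that by (auto simp: K mats_of_rank_def)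
      have "A *\<^sub>v w \<rho> = c \<cdot>\<^sub>v (A *\<^sub>v w \<pi>)" unfolding c using A(1) wc by (rule mult_mat_vec)
      also have "\<dots> = 0\<^sub>v l" unfolding A(2) by (rule eq_vecI) auto
      finally show ?thesis .
    qed
    then have "{A \<in> K. A *\<^sub>v w \<rho> = 0\<^sub>v l} = K" by auto
    then show ?thesis using True cK unfolding line by simp
  next
    case False
    have "real (card {A \<in> K. A *\<^sub>v w \<rho> = 0\<^sub>v l}) / real (card K) = r"
      using card_common_annihilators[OF wc wnz wc False, of l] l(2) cK qm
      unfolding K[symmetric] r_def by (simp add: field_simps)
    then show ?thesis using False unfolding line by (simp only: if_False)
  qed
  have "(\<Sum>A\<in>K. real (N_sol l m 1 A B)) = (\<Sum>A\<in>K. \<Sum>\<rho>\<in>?P. if A *\<^sub>v w \<rho> = 0\<^sub>v l then 1 else 0)"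
  proof (rule sum.cong[OF refl])
    fix A assume "A \<in> K"
    then have "{\<rho>. \<rho> permutes {..<m} \<and> is_pkp_solution l m 1 A B \<rho>} = ?P \<inter> {\<rho>. A *\<^sub>v w \<rho> = 0\<^sub>v l}"
      using sol by (auto simp: K_def)
    then show "real (N_sol l m 1 A B) = (\<Sum>\<rho>\<in>?P. if A *\<^sub>v w \<rho> = 0\<^sub>v l then 1 else 0)"
      unfolding N_sol_def using finP by (simp add: sum.If_cases)
  qed
  also have "\<dots> = (\<Sum>\<rho>\<in>?P. \<Sum>A\<in>K. if A *\<^sub>v w \<rho> = 0\<^sub>v l then 1 else 0)" by (rule sum.swap)
  also have "\<dots> = (\<Sum>\<rho>\<in>?P. real (card {A \<in> K. A *\<^sub>v w \<rho> = 0\<^sub>v l}))"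
    using finK by (intro sum.cong refl) (simp add: sum.If_cases Int_def)
  finally have "(\<Sum>A\<in>K. real (N_sol l m 1 A B)) / real (card K)
      = (\<Sum>\<rho>\<in>?P. if \<exists>c. \<forall>i<m. b (\<rho> i) = c * b (\<pi> i) then 1 else r)"
    by (simp only: sum_divide_distrib prob)
  \<comment> \<open>Writing 1 as \<open>r + (1 - r)\<close> separates a uniform term over all
    permutations from a correction counted by \<open>?R\<close>.\<close>
  also have "\<dots> = (\<Sum>\<rho>\<in>?P. r + (1 - r) * (if \<exists>c. \<forall>i<m. b (\<rho> i) = c * b (\<pi> i) then 1 else 0))"
    by (intro sum.cong) auto
  also have "\<dots> = r * fact m + (1 - r) * real (card ?R)"
    using finP by (simp add: sum.distrib card_permutations flip: sum_distrib_left)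
      (simp add: sum.If_cases Int_def)
  also have "card ?R = card {c. c \<noteq> 0 \<and> (*) c ` S = S}"
    unfolding S_def b_def[symmetric] using inj nz m p by (rule card_proportional_permutations)
  finally show "(\<Sum>A\<in>K. real (N_sol l m 1 A B)) / real (card K)
      = r * fact m + (1 - r) * real (card {c. c \<noteq> 0 \<and> (*) c ` S = S})" .
qed

text \<open>The three random choices become three nested averages. \<open>pmf_of_set\<close> is
  uniform only on a nonempty finite set, so most of the work is to check this for each set, along
  with finiteness of the supports.\<close>

lemma expectation_N_sol:
  assumes lm: "0 < l" "l < m" "m < CARD('a)"
  shows "measure_pmf.expectation
     (GenPKP_star l m 1 :: ('a::{finite, field} Matrix.mat \<times> 'a Matrix.mat \<times> (nat \<Rightarrow> nat)) pmf)
     (\<lambda>(A, B, \<pi>). real (N_sol l m 1 A B))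
    = (\<Sum>\<pi> | \<pi> permutes {..<m}. (\<Sum>B\<in>(star_mats_of_rank m 1 1 :: 'a Matrix.mat set).
        (\<Sum>A | A \<in> mats_of_rank l m l \<and> is_pkp_solution l m 1 A B \<pi>. real (N_sol l m 1 A B))
          / real (card {A \<in> mats_of_rank l m l. is_pkp_solution l m 1 A B \<pi>}))
        / real (card (star_mats_of_rank m 1 1 :: 'a Matrix.mat set))) / fact m"
proof -
  let ?h = "\<lambda>(A :: 'a Matrix.mat, B :: 'a Matrix.mat, \<pi> :: nat \<Rightarrow> nat). real (N_sol l m 1 A B)"
  let ?P = "{\<pi>. \<pi> permutes {..<m}}"
  let ?X = "star_mats_of_rank m 1 1 :: 'a Matrix.mat set"
  let ?K = "\<lambda>B :: 'a Matrix.mat. \<lambda>\<pi>. {A \<in> mats_of_rank l m l. is_pkp_solution l m 1 A B \<pi>}"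
  have P: "?P \<noteq> {}" "finite ?P" "card ?P = fact m"
    using permutes_id[of "{..<m}"] by (blast, simp_all add: finite_permutations card_permutations)
  have X: "finite ?X"
    by (rule finite_subset[OF _ finite_carrier_mat[of m 1]])
      (auto simp: star_mats_of_rank_def mats_of_rank_def)
  \<comment> \<open>Since \<open>m \<le> CARD('a) - 1\<close>, the binomial coefficient in the
    number of columns is positive.\<close>
  have "card ?X > 0" using lm by (simp add: card_star_columns)
  then have Xne: "?X \<noteq> {}" by auto
  have K: "finite (?K B \<pi>)" for B \<pi>
    by (rule finite_subset[OF _ finite_carrier_mat[of l m]]) (auto simp: mats_of_rank_def)
  have Kne: "?K B \<pi> \<noteq> {}" if "B \<in> ?X" "\<pi> \<in> ?P" for B \<pi>
    using mean_N_sol_given_permutation_and_column(1)[OF lm(1,2) that(1)] that(2) by simp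
  let ?fA = "\<lambda>B \<pi>. pmf_of_set (?K B \<pi>) \<bind> (\<lambda>A. return_pmf (A, B, \<pi>))"
  let ?fB = "\<lambda>\<pi>. pmf_of_set ?X \<bind> (\<lambda>B. ?fA B \<pi>)"
  have EA: "measure_pmf.expectation (?fA B \<pi>) ?h = (\<Sum>A\<in>?K B \<pi>. real (N_sol l m 1 A B)) / real (card (?K B \<pi>))"
    if "B \<in> ?X" "\<pi> \<in> ?P" for B \<pi>
    using K Kne[OF that]
    by (subst pmf_expectation_bind_pmf_of_set) (simp_all add: divide_inverse sum_distrib_left mult.commute)
  have finA: "finite (set_pmf (?fA B \<pi>))" if "B \<in> ?X" "\<pi> \<in> ?P" for B \<pi>
    using K Kne[OF that] by (simp add: set_pmf_of_set)
  have EB: "measure_pmf.expectation (?fB \<pi>) ?h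
      = (\<Sum>B\<in>?X. (\<Sum>A\<in>?K B \<pi>. real (N_sol l m 1 A B)) / real (card (?K B \<pi>))) / real (card ?X)"
    if \<pi>: "\<pi> \<in> ?P" for \<pi>
  proof -
    have "measure_pmf.expectation (?fB \<pi>) ?h
      = (\<Sum>B\<in>?X. measure_pmf.expectation (?fA B \<pi>) ?h /\<^sub>R real (card ?X))"
      using X Xne finA \<pi> by (intro pmf_expectation_bind_pmf_of_set) auto
    also have "\<dots> = (\<Sum>B\<in>?X. ((\<Sum>A\<in>?K B \<pi>. real (N_sol l m 1 A B)) / real (card (?K B \<pi>))) / real (card ?X))"
    proof (rule sum.cong[OF refl])
      fix B assume B: "B \<in> ?X"
      show "measure_pmf.expectation (?fA B \<pi>) ?h /\<^sub>R real (card ?X)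
        = ((\<Sum>A\<in>?K B \<pi>. real (N_sol l m 1 A B)) / real (card (?K B \<pi>))) / real (card ?X)"
        unfolding EA[OF B \<pi>] by (simp add: divide_inverse mult.commute)
    qed
    finally show ?thesis by (simp only: sum_divide_distrib)
  qed
  have finB: "finite (set_pmf (?fB \<pi>))" if \<pi>: "\<pi> \<in> ?P" for \<pi>
    unfolding set_bind_pmf set_pmf_of_set[OF Xne X] using X finA \<pi> by auto
  have "measure_pmf.expectation (GenPKP_star l m 1) ?h
      = (\<Sum>\<pi>\<in>?P. measure_pmf.expectation (?fB \<pi>) ?h /\<^sub>R real (card ?P))"
    unfolding GenPKP_star_def using P finB by (intro pmf_expectation_bind_pmf_of_set) auto
  also have "\<dots> = (\<Sum>\<pi>\<in>?P. measure_pmf.expectation (?fB \<pi>) ?h / fact m)"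
    by (simp add: P(3) divide_inverse mult.commute)
  also have "\<dots> = (\<Sum>\<pi>\<in>?P. (\<Sum>B\<in>?X. (\<Sum>A\<in>?K B \<pi>. real (N_sol l m 1 A B)) / real (card (?K B \<pi>)))
      / real (card ?X) / fact m)"
    by (intro sum.cong refl) (simp only: EB)
  finally show ?thesis by (simp only: sum_divide_distrib)
qed

theorem theorem4:
  fixes q l m :: nat
  assumes "CARD('a::{finite, field}) = q"
    and "0 < l" and "l < m" and "m < q"
  shows "measure_pmf.expectation
           (GenPKP_star l m 1 :: ('a Matrix.mat \<times> 'a Matrix.mat \<times> (nat \<Rightarrow> nat)) pmf)
           (\<lambda>(A, B, \<pi>). real (N_sol l m 1 A B))
       = fact m * (real q ^ (m - l) - real q) / (real q ^ m - real q)
         + (real q ^ m - real q ^ (m - l)) / ((real q ^ m - real q) * real ((q - 1) choose m))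
           * (\<Sum>d | d dvd gcd (q - 1) m.
                real (totient d) * real (((q - 1) div d) choose (m div d)))"
proof -
  note q = assms(1)
  let ?X = "star_mats_of_rank m 1 1 :: 'a Matrix.mat set"
  let ?P = "{\<pi>. \<pi> permutes {..<m}}"
  let ?stab = "\<lambda>S :: 'a set. card {c. c \<noteq> 0 \<and> (*) c ` S = S}"
  let ?e = "\<lambda>B :: 'a Matrix.mat. (\<lambda>i. B $$ (i, 0)) ` {..<m}"
  define r where "r = (real q ^ (m - l) - real q) / (real q ^ m - real q)"
  define \<Sigma> where "\<Sigma> = (\<Sum>d | d dvd gcd (q - 1) m. totient d * (((q - 1) div d) choose (m div d)))"
  have m: "m > 0" using assms by simp
  have cX: "card ?X = fact m * ((q - 1) choose m)"
    using card_star_columns[OF m, where 'a = 'a] q by simp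
  have C: "(q - 1) choose m > 0" using assms by simp
  have "real q ^ 1 < real q ^ m" using assms by (intro power_strict_increasing) auto
  then have qm: "real q ^ m - real q \<noteq> 0" by simp
  \<comment> \<open>The factor \<open>fact m\<close> will cancel against the one in
    \<open>card ?X\<close>, leaving an average over \<open>m\<close>-element sets.\<close>
  have sum_stab: "(\<Sum>B\<in>?X. ?stab (?e B)) = fact m * \<Sigma>"
    using sum_over_star_columns[OF m, of ?stab] sum_card_scaling_stabilizers[where 'a = 'a, of m]
    by (simp add: q \<Sigma>_def)
  have "(\<Sum>\<pi>\<in>?P. (\<Sum>B\<in>?X.
        (\<Sum>A | A \<in> mats_of_rank l m l \<and> is_pkp_solution l m 1 A B \<pi>. real (N_sol l m 1 A B))
          / real (card {A \<in> mats_of_rank l m l. is_pkp_solution l m 1 A B \<pi>})) / real (card ?X)) / fact m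
    = (\<Sum>\<pi>\<in>?P. (\<Sum>B\<in>?X. r * fact m + (1 - r) * real (?stab (?e B))) / real (card ?X)) / fact m"
    using mean_N_sol_given_permutation_and_column(2)[OF assms(2,3), where 'a = 'a]
    by (intro arg_cong2[where f = "(/)"] sum.cong refl) (simp add: r_def q)
  \<comment> \<open>The summand is free of \<pi>, so its \<open>fact m\<close> equal copies cancel
    the division.\<close>
  also have "\<dots> = (\<Sum>B\<in>?X. r * fact m + (1 - r) * real (?stab (?e B))) / real (card ?X)"
    by (simp add: card_permutations)
  also have "(\<Sum>B\<in>?X. r * fact m + (1 - r) * real (?stab (?e B)))
      = real (card ?X) * (r * fact m) + (1 - r) * real (\<Sum>B\<in>?X. ?stab (?e B))"
    by (simp add: sum.distrib sum_distrib_left)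
  also have "\<dots> / real (card ?X) = r * fact m + (1 - r) / real ((q - 1) choose m) * real \<Sigma>"
    using C unfolding sum_stab cX by (simp add: add_divide_distrib)
  also have "1 - r = (real q ^ m - real q ^ (m - l)) / (real q ^ m - real q)"
    using qm by (simp add: r_def diff_divide_eq_iff)
  finally show ?thesis
    using expectation_N_sol[where 'a = 'a, of l m] assms by (simp add: r_def \<Sigma>_def mult.commute)
qed

end
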